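(* Let $V$ be a finite set, $\mathcal{F}\subseteq 2^V$ a nonempty upwards-closed family, and $f:2^V\to\mathbb{R}_{\ge0}$ a nonnegative, normalized ($f(\emptyset)=0$), monotone submodular function. Consider $\min f(S): S\in\mathcal{F}$ and its natural LP $$\min\sum_{S\subseteq V}f(S)x(S)\ \text{ s.t. }\ \sum_{v\in B}\sum_{S\ni v}x(S)\ge1\ \ \forall B\in\mathcal{B}(\mathcal{F}),\quad x\ge0.$$ If $\mathcal{B}(\mathcal{F})$ is $\beta$-bounded, then this LP has integrality gap at most $\beta$, i.e. $\min_{S\in\mathcal{F}}f(S)\le\beta$ times the LP optimum.
   Context: $\mathcal{F}$ is upwards-closed if $F\in\mathcal{F}$ and $F\subseteq F'\subseteq V$ imply $F'\in\mathcal{F}$. The blocker $\mathcal{B}(\mathcal{F})$ is the family of minimal sets $B\subseteq V$ such that $B\cap F\ne\emptyset$ for every $F\in\mathcal{F}$. A family is $\beta$-bounded if each of its members has cardinality at most $\beta$. *)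

theory Defs
  imports Complex_Main
begin

definition upwards_closed :: "'a set \<Rightarrow> 'a set set \<Rightarrow> bool" where
  "upwards_closed V \<F> \<longleftrightarrow> (\<forall>F F'. F \<in> \<F> \<and> F \<subseteq> F' \<and> F' \<subseteq> V \<longrightarrow> F' \<in> \<F>)"

definition transversal :: "'a set \<Rightarrow> 'a set set \<Rightarrow> 'a set \<Rightarrow> bool" where
  "transversal V \<F> B \<longleftrightarrow> B \<subseteq> V \<and> (\<forall>F\<in>\<F>. B \<inter> F \<noteq> {})"

definition blocker :: "'a set \<Rightarrow> 'a set set \<Rightarrow> 'a set set" where
  "blocker V \<F> = {B. transversal V \<F> B \<and> (\<forall>B'. B' \<subset> B \<longrightarrow> \<not> transversal V \<F> B')}"

definition bounded_family :: "nat \<Rightarrow> 'a set set \<Rightarrow> bool" where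
  "bounded_family \<beta> \<A> \<longleftrightarrow> (\<forall>A\<in>\<A>. card A \<le> \<beta>)"

definition monotone_setfun :: "'a set \<Rightarrow> ('a set \<Rightarrow> real) \<Rightarrow> bool" where
  "monotone_setfun V f \<longleftrightarrow> (\<forall>A B. A \<subseteq> B \<and> B \<subseteq> V \<longrightarrow> f A \<le> f B)"

definition submodular :: "'a set \<Rightarrow> ('a set \<Rightarrow> real) \<Rightarrow> bool" where
  "submodular V f \<longleftrightarrow> (\<forall>A B. A \<subseteq> V \<and> B \<subseteq> V \<longrightarrow> f (A \<union> B) + f (A \<inter> B) \<le> f A + f B)"

definition lp_feasible :: "'a set \<Rightarrow> 'a set set \<Rightarrow> ('a set \<Rightarrow> real) set" where
  "lp_feasible V \<F> =
     {x. (\<forall>S\<in>Pow V. 0 \<le> x S) \<and>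
         (\<forall>B\<in>blocker V \<F>. (\<Sum>v\<in>B. \<Sum>S\<in>{S \<in> Pow V. v \<in> S}. x S) \<ge> 1)}"

definition lp_objective :: "'a set \<Rightarrow> ('a set \<Rightarrow> real) \<Rightarrow> ('a set \<Rightarrow> real) \<Rightarrow> real" where
  "lp_objective V f x = (\<Sum>S\<in>Pow V. f S * x S)"

text \<open>The infimum is over a nonempty set that is bounded below whenever \<open>\<F>\<close> is a nonempty
  family over a finite \<open>V\<close> and \<open>f\<close> is nonnegative; see the two lemmas that follow.\<close>

definition lp_optimum :: "'a set \<Rightarrow> 'a set set \<Rightarrow> ('a set \<Rightarrow> real) \<Rightarrow> real" where
  "lp_optimum V \<F> f = (INF x \<in> lp_feasible V \<F>. lp_objective V f x)"

lemma lp_feasible_nonempty: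
  assumes "finite V" and "\<F> \<noteq> {}"
  shows "lp_feasible V \<F> \<noteq> {}"
proof -
  define x :: "'a set \<Rightarrow> real" where "x = (\<lambda>S. if S = V then 1 else 0)"
  have "(\<Sum>v\<in>B. \<Sum>S\<in>{S \<in> Pow V. v \<in> S}. x S) \<ge> 1" if "B \<in> blocker V \<F>" for B
  proof -
    have B: "B \<subseteq> V" "B \<noteq> {}"
      using that assms(2) by (auto simp: blocker_def transversal_def)
    have "(\<Sum>S\<in>{S \<in> Pow V. v \<in> S}. x S) = 1" if "v \<in> B" for v
      using that B assms(1) by (auto simp: x_def sum.delta)
    hence "(\<Sum>v\<in>B. \<Sum>S\<in>{S \<in> Pow V. v \<in> S}. x S) = real (card B)"
      by simp
    moreover have "card B > 0"
      using B assms(1) by (simp add: card_gt_0_iff finite_subset)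
    ultimately show ?thesis
      by simp
  qed
  hence "x \<in> lp_feasible V \<F>"
    by (auto simp: lp_feasible_def x_def)
  thus ?thesis by blast
qed

lemma lp_objective_bdd_below:
  assumes "\<forall>S\<subseteq>V. 0 \<le> f S"
  shows "bdd_below (lp_objective V f ` lp_feasible V \<F>)"
  using assms
  by (auto intro!: bdd_belowI[of _ 0] sum_nonneg simp: lp_objective_def lp_feasible_def)

end

theory Submission
  imports Defs
begin

text \<open>Given a feasible \<open>x\<close>, put \<open>y v = (\<Sum>S\<ni>v. x S)\<close>. Every blocker member has at most \<open>\<beta>\<close>
  elements and carries \<open>y\<close>-weight at least 1, so it contains some \<open>v\<close> with \<open>\<beta> * y v \<ge> 1\<close>. Hence the
  set \<open>U\<close> of all such \<open>v\<close> meets every blocker member, that is, \<open>U \<in> \<F>\<close>. The greedy vertex of the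
  polymatroid of \<open>f\<close> restricted to \<open>U\<close> is a modular \<open>w \<ge> 0\<close> below \<open>f\<close> with \<open>w U = f U\<close>; it
  gives \<open>f U = (\<Sum>u\<in>U. w u) \<le> \<beta> * (\<Sum>u\<in>U. w u * y u) \<le> \<beta> * (\<Sum>S. f S * x S)\<close>.\<close>

lemma minimal_transversal_subset:
  assumes "finite V" "transversal V \<F> T"
  obtains B where "B \<in> blocker V \<F>" "B \<subseteq> T"
proof -
  have "finite {B. transversal V \<F> B}"
    using assms(1) by (rule_tac finite_subset[of _ "Pow V"]) (auto simp: transversal_def)
  then obtain B where "transversal V \<F> B" "B \<subseteq> T"
      "\<forall>B'\<in>{B. transversal V \<F> B}. B' \<subseteq> B \<longrightarrow> B = B'"
    using finite_has_minimal2[of "{B. transversal V \<F> B}" T] assms(2) by auto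
  then show thesis
    using that unfolding blocker_def by blast
qed

text \<open>If \<open>U\<close> were not in \<open>\<F>\<close>, upward closure would forbid any
  member of \<open>\<F>\<close> inside \<open>U\<close>. Then \<open>V - U\<close> is a transversal,
  and a minimal transversal inside it misses \<open>U\<close>.\<close>

lemma mem_if_meets_blocker:
  assumes "finite V" "\<F> \<subseteq> Pow V" "upwards_closed V \<F>" "U \<subseteq> V"
    and meets: "\<And>B. B \<in> blocker V \<F> \<Longrightarrow> B \<inter> U \<noteq> {}"
  shows "U \<in> \<F>"
proof (rule ccontr)
  assume "U \<notin> \<F>"
  then have "\<not> F \<subseteq> U" if "F \<in> \<F>" for F
    using that assms(3,4) unfolding upwards_closed_def by blast
  then have "transversal V \<F> (V - U)"
    using assms(2) unfolding transversal_def by blast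
  then obtain B where "B \<in> blocker V \<F>" "B \<subseteq> V - U"
    using minimal_transversal_subset assms(1) by blast
  then show False
    using meets by blast
qed

text \<open>Elements are added one at a time, each weighted by its marginal value. Monotonicity
  makes the weights nonnegative; submodularity keeps them below \<open>f\<close> on all
  subsets.\<close>

lemma greedy_modular_minorant:
  fixes f :: "'a set \<Rightarrow> real"
  assumes "finite U" "U \<subseteq> V" "f {} = 0" "monotone_setfun V f" "submodular V f"
  shows "\<exists>w. (\<forall>u\<in>U. 0 \<le> w u) \<and> sum w U = f U \<and> (\<forall>T\<subseteq>U. sum w T \<le> f T)"
  using assms(1,2)
proof (induction U)
  case empty
  then show ?case using assms(3) by simp
next
  case (insert u U)
  then obtain w where w: "\<forall>v\<in>U. 0 \<le> w v" "sum w U = f U" "\<forall>T\<subseteq>U. sum w T \<le> f T"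
    by auto
  define w' where "w' = w(u := f (insert u U) - f U)"
  have w'_eq: "sum w' T = sum w T" if "T \<subseteq> U" for T
    using that insert.hyps by (intro sum.cong) (auto simp: w'_def)
  have w'_u: "w' u = f (insert u U) - f U"
    by (simp add: w'_def)
  have "f U \<le> f (insert u U)"
    using assms(4) insert.prems unfolding monotone_setfun_def by blast
  then have "\<forall>v\<in>insert u U. 0 \<le> w' v"
    using w(1) by (simp add: w'_def)
  moreover have "sum w' (insert u U) = f (insert u U)"
    using insert.hyps w'_eq[of U] w(2) w'_u by simp
  moreover have "sum w' T \<le> f T" if T: "T \<subseteq> insert u U" for T
  proof (cases "u \<in> T")
    case True
    have TU: "T - {u} \<subseteq> U" and fin: "finite T"
      using T insert.hyps by (auto intro: finite_subset)
    have "sum w' T = f (insert u U) - f U + sum w (T - {u})"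
      using sum.remove[OF fin True, of w'] w'_eq[OF TU] w'_u by simp
    also have "\<dots> \<le> f (insert u U) - f U + f (T - {u})"
      using w(3) TU by simp
    \<comment> \<open>Diminishing returns: the marginal value of \<open>u\<close> over
      \<open>U\<close> is at most that over the smaller set \<open>T - {u}\<close>. This is
      submodularity for the pair \<open>U\<close>, \<open>T\<close>.\<close>
    also have "\<dots> \<le> f T"
    proof -
      have "U \<union> T = insert u U" "U \<inter> T = T - {u}"
        using T True insert.hyps by auto
      moreover have "U \<subseteq> V" "T \<subseteq> V"
        using T insert.prems by auto
      ultimately have "f (insert u U) + f (T - {u}) \<le> f U + f T"
        using assms(5) unfolding submodular_def by metis
      then show ?thesis
        by linarith
    qed
    finally show ?thesis .
  next
    case False
    then have "T \<subseteq> U"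
      using T by blast
    then show ?thesis
      using w(3) w'_eq by simp
  qed
  ultimately show ?case
    by blast
qed

text \<open>With \<open>f\<close> on \<open>U\<close> replaced by a modular minorant
  \<open>w\<close> that is tight at \<open>U\<close>, this becomes double counting over pairs
  \<open>u \<in> S\<close>.\<close>

lemma submodular_fractional_cover:
  fixes f x :: "'a set \<Rightarrow> real"
  assumes "finite V" "U \<subseteq> V" "f {} = 0" "monotone_setfun V f" "submodular V f"
    and x: "\<And>S. S \<subseteq> V \<Longrightarrow> 0 \<le> x S"
    and cover: "\<And>u. u \<in> U \<Longrightarrow> c \<le> (\<Sum>S\<in>{S \<in> Pow V. u \<in> S}. x S)"
  shows "c * f U \<le> (\<Sum>S\<in>Pow V. f S * x S)"
proof -
  have fin: "finite U"
    using assms(1,2) finite_subset by blast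
  then obtain w where w: "\<forall>u\<in>U. 0 \<le> w u" "sum w U = f U" "\<forall>T\<subseteq>U. sum w T \<le> f T"
    using greedy_modular_minorant[OF _ assms(2-5)] by blast
  have "c * f U = (\<Sum>u\<in>U. w u * c)"
    by (simp add: w(2)[symmetric] sum_distrib_left mult.commute)
  also have "\<dots> \<le> (\<Sum>u\<in>U. w u * (\<Sum>S\<in>{S \<in> Pow V. u \<in> S}. x S))"
    using w(1) cover by (intro sum_mono mult_left_mono) auto
  also have "\<dots> = (\<Sum>u\<in>U. \<Sum>S | S \<in> Pow V \<and> u \<in> S. w u * x S)"
    by (simp add: sum_distrib_left)
  also have "\<dots> = (\<Sum>S\<in>Pow V. \<Sum>u | u \<in> U \<and> u \<in> S. w u * x S)"
    using fin assms(1) by (intro sum.swap_restrict) auto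
  also have "\<dots> = (\<Sum>S\<in>Pow V. sum w (S \<inter> U) * x S)"
    by (simp add: sum_distrib_right Int_def conj_commute)
  also have "\<dots> \<le> (\<Sum>S\<in>Pow V. f S * x S)"
  proof (intro sum_mono mult_right_mono)
    fix S assume S: "S \<in> Pow V"
    then show "0 \<le> x S"
      using x by simp
    \<comment> \<open>\<open>w\<close> is controlled only on subsets of \<open>U\<close>;
      monotonicity then passes from \<open>S \<inter> U\<close> to \<open>S\<close>.\<close>
    have "sum w (S \<inter> U) \<le> f (S \<inter> U)"
      using w(3) by simp
    also have "\<dots> \<le> f S"
      using S assms(4) by (auto simp: monotone_setfun_def)
    finally show "sum w (S \<inter> U) \<le> f S" .
  qed
  finally show ?thesis .
qed

theorem theorem9:
  fixes V :: "'a set" and \<F> :: "'a set set" and f :: "'a set \<Rightarrow> real" and \<beta> :: nat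
  assumes "finite V"
    and "\<F> \<subseteq> Pow V"
    and "\<F> \<noteq> {}"
    and "upwards_closed V \<F>"
    and "\<forall>S\<subseteq>V. 0 \<le> f S"
    and "f {} = 0"
    and "monotone_setfun V f"
    and "submodular V f"
    and "bounded_family \<beta> (blocker V \<F>)"
  shows "Min (f ` \<F>) \<le> real \<beta> * lp_optimum V \<F> f"
proof -
  have fin: "finite \<F>"
    using assms(1,2) finite_subset by blast
  have bound: "Min (f ` \<F>) \<le> real \<beta> * lp_objective V f x" if x: "x \<in> lp_feasible V \<F>" for x
  proof -
    define y where "y v = (\<Sum>S\<in>{S \<in> Pow V. v \<in> S}. x S)" for v
    define U where "U = {v \<in> V. 1 \<le> real \<beta> * y v}"
    have "B \<inter> U \<noteq> {}" if B: "B \<in> blocker V \<F>" for B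
    proof
      assume disj: "B \<inter> U = {}"
      have BV: "B \<subseteq> V"
        using B by (simp add: blocker_def transversal_def)
      have y_B: "1 \<le> sum y B"
        using x B by (simp add: lp_feasible_def y_def)
      then have "B \<noteq> {}"
        by auto
      moreover have "finite B"
        using BV assms(1) finite_subset by blast
      moreover have "real \<beta> * y v < 1" if "v \<in> B" for v
        using that disj BV by (force simp: U_def)
      \<comment> \<open>Averaging: if \<open>B\<close> missed \<open>U\<close>, then \<open>\<beta>
        * sum y B < card B \<le> \<beta> \<le> \<beta> * sum y B\<close>. The first inequality is
        strict because \<open>B\<close> is nonempty.\<close>
      ultimately have "(\<Sum>v\<in>B. real \<beta> * y v) < (\<Sum>v\<in>B. 1)"
        by (intro sum_strict_mono) auto
      also have "\<dots> \<le> real \<beta>"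
        using assms(9) B by (simp add: bounded_family_def)
      also have "\<dots> \<le> real \<beta> * sum y B"
        using mult_left_mono[OF y_B, of "real \<beta>"] by simp
      finally show False
        by (simp add: sum_distrib_left)
    qed
    then have U: "U \<in> \<F>"
      using assms(1,2,4) by (intro mem_if_meets_blocker) (auto simp: U_def)
    \<comment> \<open>Scaling \<open>x\<close> by \<open>\<beta>\<close> and covering at level 1
      avoids the level \<open>1 / \<beta>\<close>, as \<open>\<beta>\<close> may be 0.\<close>
    have "1 * f U \<le> (\<Sum>S\<in>Pow V. f S * (real \<beta> * x S))"
    proof (rule submodular_fractional_cover[OF assms(1) _ assms(6-8)])
      show "U \<subseteq> V"
        by (auto simp: U_def)
      show "0 \<le> real \<beta> * x S" if "S \<subseteq> V" for S
        using that x by (simp add: lp_feasible_def)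
      show "1 \<le> (\<Sum>S\<in>{S \<in> Pow V. u \<in> S}. real \<beta> * x S)" if "u \<in> U" for u
        using that by (simp add: U_def y_def sum_distrib_left)
    qed
    also have "\<dots> = real \<beta> * lp_objective V f x"
      by (simp add: lp_objective_def sum_distrib_left mult_ac)
    finally have "f U \<le> real \<beta> * lp_objective V f x"
      by simp
    moreover have "Min (f ` \<F>) \<le> f U"
      using U fin by simp
    ultimately show ?thesis
      by linarith
  qed
  have ne: "lp_feasible V \<F> \<noteq> {}"
    using lp_feasible_nonempty assms(1,3) by blast
  show ?thesis
  \<comment> \<open>Passing to the infimum divides by \<open>\<beta>\<close>. For
    \<open>\<beta> = 0\<close>, \<open>bound\<close> at any feasible point has the same right-hand
    side 0 as the goal.\<close>
  proof (cases "\<beta> = 0")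
    case True
    then show ?thesis
      using bound ne by auto
  next
    case False
    then have "Min (f ` \<F>) / real \<beta> \<le> lp_optimum V \<F> f"
      unfolding lp_optimum_def using bound ne
      by (intro cINF_greatest) (auto simp: field_simps)
    then show ?thesis
      using False by (simp add: field_simps)
  qed
qed

end
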